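(* Let $R$ be a commutative ring with unity that has no nontrivial idempotents (i.e. $\mathrm{Id}(R)=\{0,1\}$). Then: (i) If $|U(R)|=1$, then $\mathrm{Cl}(R)\cong K_2$. (ii) If $|U(R)|\ge 2$, then two distinct vertices $(e,u)$ and $(f,v)$ of $\mathrm{Cl}(R)$ are mutually maximally distant in $\mathrm{Cl}(R)$ if and only if either $e=f=0$ or $e=f=1$.
   Context: All rings are commutative with unity. $U(R)$ is the set of units of $R$ and $\mathrm{Id}(R)$ the set of idempotents ($e^2=e$). The clean graph $\mathrm{Cl}(R)$ is the simple undirected graph with vertex set $\{(e,u): e\in \mathrm{Id}(R),\ u\in U(R)\}$ (ordered pairs), in which two distinct vertices $(e,u),(f,v)$ are adjacent if and only if $ef=0$ or $uv=1$. For vertices $x,y$ of a connected graph, $d(x,y)$ is the length of a shortest path and $N(x)$ the set of neighbours of $x$. A vertex $x$ is maximally distant from $y$ if $d(y,w)\le d(x,y)$ for every $w\in N(x)$; $x$ and $y$ are mutually maximally distant if each is maximally distant from the other. $K_2$ is the complete graph on two vertices. *)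

theory Defs
  imports "HOL-Algebra.Ring" "Graph_Theory.Graph_Theory"
begin

text \<open>A simple undirected graph is represented by its symmetric irreflexive adjacency relation on
  the vertex set, i.e. as a \<^locale>\<open>pair_bidirected_digraph\<close>, which unlike \<^locale>\<open>graph\<close>
  allows infinitely many vertices.\<close>

definition idempotents :: "('a, 'm) ring_scheme \<Rightarrow> 'a set" where
  "idempotents R = {e \<in> carrier R. e \<otimes>\<^bsub>R\<^esub> e = e}"

definition clean_graph :: "('a, 'm) ring_scheme \<Rightarrow> ('a \<times> 'a) pair_pre_digraph" where
  "clean_graph R = \<lparr>
     pverts = idempotents R \<times> Units R,
     parcs = {((e, u), (f, v)) | e u f v.
       (e, u) \<in> idempotents R \<times> Units R \<and> (f, v) \<in> idempotents R \<times> Units R \<and>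
       (e, u) \<noteq> (f, v) \<and> (e \<otimes>\<^bsub>R\<^esub> f = \<zero>\<^bsub>R\<^esub> \<or> u \<otimes>\<^bsub>R\<^esub> v = \<one>\<^bsub>R\<^esub>)} \<rparr>"

definition complete_graph :: "nat \<Rightarrow> nat pair_pre_digraph" where
  "complete_graph n = \<lparr> pverts = {..<n}, parcs = {(i, j). i < n \<and> j < n \<and> i \<noteq> j} \<rparr>"

text \<open>Meaningful only if \<^term>\<open>y\<close> is reachable from \<^term>\<open>x\<close>; see \<open>gdist_eq_\<mu>\<close> for the relation
  to the weighted distance of the library.\<close>

definition gdist :: "('a, 'b) pre_digraph \<Rightarrow> 'a \<Rightarrow> 'a \<Rightarrow> nat" where
  "gdist G x y = (LEAST n. \<exists>p. pre_digraph.apath G x p y \<and> length p = n)"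

definition neighbours :: "('a, 'b) pre_digraph \<Rightarrow> 'a \<Rightarrow> 'a set" where
  "neighbours G x = {w. x \<rightarrow>\<^bsub>G\<^esub> w}"

definition maximally_distant :: "('a, 'b) pre_digraph \<Rightarrow> 'a \<Rightarrow> 'a \<Rightarrow> bool" where
  "maximally_distant G x y \<longleftrightarrow> (\<forall>w \<in> neighbours G x. gdist G y w \<le> gdist G x y)"

definition mutually_maximally_distant :: "('a, 'b) pre_digraph \<Rightarrow> 'a \<Rightarrow> 'a \<Rightarrow> bool" where
  "mutually_maximally_distant G x y \<longleftrightarrow> maximally_distant G x y \<and> maximally_distant G y x"

lemma complete_digraph_complete_graph: "complete_digraph n (with_proj (complete_graph n))"
  by (auto simp: complete_digraph_pair_def complete_graph_def)

lemma (in wf_digraph) gdist_eq_\<mu>: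
  assumes "u \<rightarrow>\<^sup>* v"
  shows "ereal (real (gdist G u v)) = \<mu> (\<lambda>_. 1) u v"
proof -
  have cost: "awalk_cost (\<lambda>_. 1) p = real (length p)" for p :: "'b list"
    by (induction p) (auto simp: awalk_cost_def)
  obtain q where q: "apath u q v"
    using assms reachable_apath by blast
  have ex: "\<exists>p. apath u p v \<and> length p = gdist G u v"
    unfolding gdist_def by (rule LeastI_ex) (use q in blast)
  show ?thesis
  proof (rule antisym)
    show "ereal (real (gdist G u v)) \<le> \<mu> (\<lambda>_. 1) u v"
      unfolding \<mu>_def
    proof (rule INF_greatest, clarify)
      fix p assume p: "awalk u p v"
      have "apath u (awalk_to_apath p) v" using p by (rule apath_awalk_to_apath)
      then have "gdist G u v \<le> length (awalk_to_apath p)"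
        unfolding gdist_def by (intro Least_le) blast
      also have "\<dots> \<le> length p"
        using p
      proof (induction rule: awalk_to_apath_induct)
        case (path p)
        then have "awalk_to_apath p = p"
          by (auto simp: awalk_to_apath.simps)
        then show ?case by simp
      next
        case (decomp p q r s)
        have "p = q @ r @ s"
          using awalk_cyc_decomp_has_prop[OF decomp(1,3)] decomp(2) by auto
        then show ?case
          using decomp step_awalk_to_apath[of u p v q r s] by auto
      qed
      finally show "ereal (real (gdist G u v)) \<le> ereal (awalk_cost (\<lambda>_. 1) p)"
        by (simp add: cost)
    qed
    obtain p where "awalk u p v" "length p = gdist G u v"
      using ex by (auto simp: apath_def)
    then show "\<mu> (\<lambda>_. 1) u v \<le> ereal (real (gdist G u v))"
      using min_cost_le_walk_cost[of u p v "\<lambda>_. 1"] by (simp add: cost)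
  qed
qed

lemma pair_bidirected_clean_graph:
  assumes "cring R"
  shows "pair_bidirected_digraph (clean_graph R)"
proof -
  interpret cring R by fact
  have *: "e \<in> carrier R" if "e \<in> idempotents R" for e
    using that by (simp add: idempotents_def)
  show ?thesis
    by unfold_locales
      (auto simp: clean_graph_def symmetric_def intro!: symI, (metis * Units_closed m_comm)+)
qed

lemma clean_graph_reachable:
  assumes "cring R" "x \<in> pverts (clean_graph R)" "y \<in> pverts (clean_graph R)"
  shows "x \<rightarrow>\<^sup>*\<^bsub>with_proj (clean_graph R)\<^esub> y"
proof -
  interpret cring R by fact
  interpret G: pair_bidirected_digraph "clean_graph R"
    using assms(1) by (rule pair_bidirected_clean_graph)
  let ?z = "(\<zero>\<^bsub>R\<^esub>, \<one>\<^bsub>R\<^esub>)"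
  have z: "?z \<in> pverts (clean_graph R)"
    by (simp add: clean_graph_def idempotents_def)
  have "w = ?z \<or> (w, ?z) \<in> parcs (clean_graph R) \<and> (?z, w) \<in> parcs (clean_graph R)"
    if "w \<in> pverts (clean_graph R)" for w
    using that by (cases w) (auto simp: clean_graph_def idempotents_def)
  then have "w \<rightarrow>\<^sup>*\<^bsub>with_proj (clean_graph R)\<^esub> ?z \<and> ?z \<rightarrow>\<^sup>*\<^bsub>with_proj (clean_graph R)\<^esub> w"
    if "w \<in> pverts (clean_graph R)" for w
    using that z by (metis G.reachable_adjI G.reachable_refl)
  then show ?thesis
    using assms(2,3) G.reachable_trans by blast
qed

end

theory Submission
  imports Defs
begin

text \<open>The vertices \<open>(0, u)\<close> are adjacent to all others, so distinct vertices are at distance 1 or 2,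
  and distance 2 occurs exactly between \<open>(1, u)\<close> and \<open>(1, v)\<close> with \<open>u \<noteq> v\<close> and \<open>uv \<noteq> 1\<close>.
  Two vertices \<open>(0, u)\<close> and \<open>(0, v)\<close> are at distance at most 1 from everything. If \<open>(1, u)\<close> and
  \<open>(1, v)\<close> are adjacent, then \<open>v\<close> is the inverse of \<open>u\<close>, so each is the only neighbour of the other
  with first component 1. Finally, given \<open>(0, u)\<close> and \<open>(1, v)\<close>, there is a unit \<open>w \<noteq> v\<close> with
  \<open>vw \<noteq> 1\<close>, and the neighbour \<open>(1, w)\<close> of \<open>(0, u)\<close> is farther from \<open>(1, v)\<close> than \<open>(0, u)\<close> is.\<close>

text \<open>All pairs of distinct vertices are arcs on both sides, so any enumeration
  \<open>h\<close> of the vertices is an isomorphism. \<open>digraph_iso\<close> also asks for a map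
  on arcs; as these are pairs of vertices, \<open>map_prod h h\<close> serves.\<close>

lemma digraph_iso_complete_graph:
  assumes "complete_digraph n (with_proj G)"
  shows "digraph_iso (with_proj G) (with_proj (complete_graph n))"
proof -
  have fin: "finite (pverts G)" and card: "card (pverts G) = n"
    and arcs: "parcs G = {(u, v). (u, v) \<in> pverts G \<times> pverts G \<and> u \<noteq> v}"
    using assms by (auto simp: complete_digraph_pair_def)
  obtain h where "bij_betw h (pverts G) {0..<n}"
    using ex_bij_betw_finite_nat[OF fin] card by auto
  then have inj: "inj_on h (pverts G)" and img: "h ` pverts G = {..<n}"
    by (auto simp: bij_betw_def lessThan_atLeast0)
  have arcs_img: "map_prod h h ` parcs G = {(i, j). i < n \<and> j < n \<and> i \<noteq> j}"
  proof (intro equalityI subsetI)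
    fix a assume "a \<in> map_prod h h ` parcs G"
    then show "a \<in> {(i, j). i < n \<and> j < n \<and> i \<noteq> j}"
      using img inj by (auto simp: arcs inj_on_eq_iff)
  next
    fix a assume "a \<in> {(i, j). i < n \<and> j < n \<and> i \<noteq> j}"
    then obtain i j where a: "a = (i, j)" "i \<in> h ` pverts G" "j \<in> h ` pverts G" "i \<noteq> j"
      using img by auto
    then show "a \<in> map_prod h h ` parcs G"
      by (force simp: arcs)
  qed
  have "inj_on (map_prod h h) (parcs G)"
    by (rule inj_on_subset[OF map_prod_inj_on[OF inj inj]]) (auto simp: arcs)
  moreover have "wf_digraph (with_proj G)"
    by unfold_locales (auto simp: arcs)
  ultimately show ?thesis
    unfolding digraph_iso_def pre_digraph.digraph_isomorphism_def
    using inj img arcs_img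
    by (intro exI[of _ "\<lparr>iso_verts = h, iso_arcs = map_prod h h, iso_head = snd, iso_tail = fst\<rparr>"])
      (auto simp: app_iso_def with_proj_def complete_graph_def)
qed

lemma (in wf_digraph) gdist_universal_vertex:
  assumes u: "u \<in> verts G" and v: "v \<in> verts G"
    and univ: "\<And>w. w \<in> verts G \<Longrightarrow> w \<noteq> z \<Longrightarrow> w \<rightarrow>\<^bsub>G\<^esub> z \<and> z \<rightarrow>\<^bsub>G\<^esub> w"
  shows "gdist G u v = (if u = v then 0 else if u \<rightarrow>\<^bsub>G\<^esub> v then 1 else 2)"
proof -
  have pos: "1 \<le> length p" if "apath u p v" "u \<noteq> v" for p
    using that by (cases p) (auto simp: apath_Nil_iff)
  have ge2: "2 \<le> length p" if "apath u p v" "u \<noteq> v" "\<not> u \<rightarrow>\<^bsub>G\<^esub> v" for p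
  proof (cases p)
    case (Cons e q)
    then show ?thesis
      using that by (cases q) (auto simp: apath_simps dominatesI arc_to_ends_def)
  qed (use that in \<open>auto simp: apath_Nil_iff\<close>)
  consider "u = v" | "u \<noteq> v" "u \<rightarrow>\<^bsub>G\<^esub> v" | "u \<noteq> v" "\<not> u \<rightarrow>\<^bsub>G\<^esub> v"
    by blast
  then show ?thesis
  proof cases
    case 1
    then have "apath u [] v"
      using u by (simp add: apath_Nil_iff)
    then show ?thesis
      using 1 unfolding gdist_def by (auto intro!: Least_equality)
  next
    case 2
    then obtain e where "e \<in> arcs G" "tail G e = u" "head G e = v"
      by (auto simp: arcs_ends_conv)
    then have "apath u [e] v"
      using 2 v by (auto simp: apath_simps)
    then have "\<exists>p. apath u p v \<and> length p = 1"
      by (intro exI[of _ "[e]"]) simp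
    then show ?thesis
      using 2 pos unfolding gdist_def by (auto intro!: Least_equality)
  next
    case 3
    \<comment> \<open>\<open>z\<close> is joined to every other vertex, so neither of two distinct
      non-adjacent vertices can be \<open>z\<close>. Hence the walk from \<open>u\<close> via
      \<open>z\<close> to \<open>v\<close> repeats no vertex.\<close>
    then have "u \<noteq> z" "v \<noteq> z"
      using univ u v by auto
    then obtain e f where "e \<in> arcs G" "tail G e = u" "head G e = z"
      "f \<in> arcs G" "tail G f = z" "head G f = v"
      using univ[OF u] univ[OF v] by (auto simp: arcs_ends_conv)
    then have "apath u [e, f] v"
      using 3 v \<open>u \<noteq> z\<close> \<open>v \<noteq> z\<close> by (auto simp: apath_simps)
    then have "\<exists>p. apath u p v \<and> length p = 2"
      by (intro exI[of _ "[e, f]"]) simp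
    then show ?thesis
      using 3 ge2 unfolding gdist_def by (auto intro!: Least_equality)
  qed
qed

lemma clean_graph_adj_iff:
  "(e, u) \<rightarrow>\<^bsub>with_proj (clean_graph R)\<^esub> (f, v) \<longleftrightarrow>
     e \<in> idempotents R \<and> u \<in> Units R \<and> f \<in> idempotents R \<and> v \<in> Units R \<and>
     (e, u) \<noteq> (f, v) \<and> (e \<otimes>\<^bsub>R\<^esub> f = \<zero>\<^bsub>R\<^esub> \<or> u \<otimes>\<^bsub>R\<^esub> v = \<one>\<^bsub>R\<^esub>)"
  by (auto simp: clean_graph_def)

lemma gdist_clean_graph:
  assumes "cring R" "x \<in> pverts (clean_graph R)" "y \<in> pverts (clean_graph R)"
  shows "gdist (with_proj (clean_graph R)) x y =
    (if x = y then 0 else if x \<rightarrow>\<^bsub>with_proj (clean_graph R)\<^esub> y then 1 else 2)"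
proof -
  interpret cring R by fact
  interpret G: pair_bidirected_digraph "clean_graph R"
    using assms(1) by (rule pair_bidirected_clean_graph)
  have "wf_digraph (with_proj (clean_graph R))"
    by unfold_locales
  then show ?thesis
    \<comment> \<open>A zero first component makes every product of idempotents vanish, so this
      vertex is adjacent to all others.\<close>
    by (rule wf_digraph.gdist_universal_vertex[where z = "(\<zero>\<^bsub>R\<^esub>, \<one>\<^bsub>R\<^esub>)"])
      (use assms(2,3) in \<open>auto simp: clean_graph_def idempotents_def\<close>)
qed

text \<open>For \<open>v = \<one>\<close> any other unit works, since
  \<open>v \<otimes> w = w\<close>; for \<open>v \<noteq> \<one>\<close> the choice
  \<open>w = \<one>\<close> works. The infinite case is listed separately because
  \<open>card\<close> is 0 there.\<close>

lemma (in monoid) ex_unit_neq_nor_inverse: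
  assumes "infinite (Units G) \<or> card (Units G) \<ge> 2" "v \<in> Units G"
  shows "\<exists>w \<in> Units G. w \<noteq> v \<and> v \<otimes> w \<noteq> \<one>"
proof (cases "v = \<one>")
  case True
  have "\<not> Units G \<subseteq> {\<one>}"
    using assms(1) card_mono[of "{\<one>}" "Units G"] by (auto dest: finite_subset)
  then show ?thesis
    using True by (auto simp: Units_closed)
next
  case False
  then show ?thesis
    using assms(2) by (intro bexI[of _ \<one>]) auto
qed

theorem theorem3p1:
  fixes R :: "('a, 'm) ring_scheme"
  assumes "cring R"
    and "\<zero>\<^bsub>R\<^esub> \<noteq> \<one>\<^bsub>R\<^esub>"
    and "idempotents R = {\<zero>\<^bsub>R\<^esub>, \<one>\<^bsub>R\<^esub>}"
  shows "(card (Units R) = 1 \<longrightarrow>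
            digraph_iso (with_proj (clean_graph R)) (with_proj (complete_graph 2))) \<and>
         (infinite (Units R) \<or> card (Units R) \<ge> 2 \<longrightarrow>
            (\<forall>e u f v. (e, u) \<in> pverts (clean_graph R) \<longrightarrow> (f, v) \<in> pverts (clean_graph R) \<longrightarrow>
               (e, u) \<noteq> (f, v) \<longrightarrow>
               (mutually_maximally_distant (with_proj (clean_graph R)) (e, u) (f, v) \<longleftrightarrow>
                  (e = \<zero>\<^bsub>R\<^esub> \<and> f = \<zero>\<^bsub>R\<^esub>) \<or> (e = \<one>\<^bsub>R\<^esub> \<and> f = \<one>\<^bsub>R\<^esub>))))"
proof (intro conjI impI allI)
  interpret cring R by fact
  assume "card (Units R) = 1"
  then have "Units R = {\<one>\<^bsub>R\<^esub>}"
    by (metis Units_one_closed card_1_singletonE singletonD)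
  \<comment> \<open>The only vertices are (0, 1) and (1, 1), adjacent because 0 * 1 = 0.\<close>
  then have "complete_digraph 2 (with_proj (clean_graph R))"
    using assms(2,3) by (auto simp: complete_digraph_pair_def clean_graph_def)
  then show "digraph_iso (with_proj (clean_graph R)) (with_proj (complete_graph 2))"
    by (rule digraph_iso_complete_graph)
next
  interpret cring R by fact
  let ?G = "with_proj (clean_graph R)"
  fix e u f v
  assume two: "infinite (Units R) \<or> card (Units R) \<ge> 2"
    and eu: "(e, u) \<in> pverts (clean_graph R)" and fv: "(f, v) \<in> pverts (clean_graph R)"
    and neq: "(e, u) \<noteq> (f, v)"
  have verts: "pverts (clean_graph R) = {\<zero>\<^bsub>R\<^esub>, \<one>\<^bsub>R\<^esub>} \<times> Units R"
    using assms(3) by (simp add: clean_graph_def)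
  note dist = gdist_clean_graph[OF assms(1)]
  note adj = clean_graph_adj_iff[where R = R, unfolded assms(3)]
  have zero: "maximally_distant ?G (\<zero>\<^bsub>R\<^esub>, a) (\<zero>\<^bsub>R\<^esub>, b)"
    if "a \<in> Units R" "b \<in> Units R" "a \<noteq> b" for a b
    using that by (auto simp: maximally_distant_def neighbours_def dist adj verts simp del: with_proj_simps)
  have one: "maximally_distant ?G (\<one>\<^bsub>R\<^esub>, a) (\<one>\<^bsub>R\<^esub>, b)"
    if ab: "a \<in> Units R" "b \<in> Units R" "a \<noteq> b" for a b
    unfolding maximally_distant_def
  proof
    fix w assume w: "w \<in> neighbours ?G (\<one>\<^bsub>R\<^esub>, a)"
    obtain g c where gc: "w = (g, c)" by (cases w)
    \<comment> \<open>Only \<open>a \<otimes> b = \<one>\<close> is critical, as otherwise the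
      distance is already 2. Then a neighbour \<open>(g, c)\<close> of \<open>(\<one>, a)\<close>
      has \<open>g = \<zero>\<close> or, by uniqueness of inverses, equals
      \<open>(\<one>, b)\<close>; both are within distance 1 of \<open>(\<one>, b)\<close>.\<close>
    have uniq: "c = b" if "a \<otimes>\<^bsub>R\<^esub> c = \<one>\<^bsub>R\<^esub>" "a \<otimes>\<^bsub>R\<^esub> b = \<one>\<^bsub>R\<^esub>" "c \<in> Units R"
      using that ab by (metis Units_closed Units_l_cancel)
    show "gdist ?G (\<one>\<^bsub>R\<^esub>, b) w \<le> gdist ?G (\<one>\<^bsub>R\<^esub>, a) (\<one>\<^bsub>R\<^esub>, b)"
      using w ab uniq assms(2)
      by (auto simp: neighbours_def dist adj verts gc simp del: with_proj_simps)
  qed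
  have mixed: "\<not> maximally_distant ?G (\<zero>\<^bsub>R\<^esub>, a) (\<one>\<^bsub>R\<^esub>, b)"
    if ab: "a \<in> Units R" "b \<in> Units R" for a b
  proof -
    \<comment> \<open>This choice puts \<open>(\<one>, c)\<close> at distance 2 from
      \<open>(\<one>, b)\<close>, while \<open>(\<zero>, a)\<close> is at distance 1 from
      it.\<close>
    obtain c where c: "c \<in> Units R" "c \<noteq> b" "b \<otimes>\<^bsub>R\<^esub> c \<noteq> \<one>\<^bsub>R\<^esub>"
      using ex_unit_neq_nor_inverse[OF two ab(2)] by blast
    have "(\<one>\<^bsub>R\<^esub>, c) \<in> neighbours ?G (\<zero>\<^bsub>R\<^esub>, a)"
      using ab c assms(2) by (auto simp: neighbours_def adj simp del: with_proj_simps)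
    moreover have "gdist ?G (\<one>\<^bsub>R\<^esub>, b) (\<one>\<^bsub>R\<^esub>, c) > gdist ?G (\<zero>\<^bsub>R\<^esub>, a) (\<one>\<^bsub>R\<^esub>, b)"
      using ab c assms(2) by (auto simp: dist adj verts simp del: with_proj_simps)
    ultimately show ?thesis
      unfolding maximally_distant_def by (meson not_less)
  qed
  show "mutually_maximally_distant ?G (e, u) (f, v) \<longleftrightarrow>
    (e = \<zero>\<^bsub>R\<^esub> \<and> f = \<zero>\<^bsub>R\<^esub>) \<or> (e = \<one>\<^bsub>R\<^esub> \<and> f = \<one>\<^bsub>R\<^esub>)"
    \<comment> \<open>For \<open>e = f\<close>, distinctness of the vertices gives
      \<open>u \<noteq> v\<close>. For \<open>e \<noteq> f\<close>, \<open>mixed\<close> refutes one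
      of the two conjuncts, which one depending on whether \<open>e\<close> or \<open>f\<close> is
      zero.\<close>
    using eu fv neq zero one mixed assms(2)
    unfolding mutually_maximally_distant_def verts by auto
qed

end
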